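(* Let $\alpha\in(0,1)$, $\eta>0$, $\gamma>0$, $a=1$, $b\in\mathbb R\setminus\{0\}$, and assume $b\neq\frac{\pi}{\sqrt2}\frac{k_1^2-k_2^2}{\sqrt{k_1^2+k_2^2}}$ for all $k_1,k_2\in\mathbb Z$ with $(k_1,k_2)\neq(0,0)$. Then the semigroup of contractions $e^{t\mathcal A}$ is not uniformly (exponentially) stable in the energy space $\mathcal H$.
   Context: Let $\mu(\xi)=|\xi|^{\frac{2\alpha-1}{2}}$ and $\kappa(\alpha)=\frac{\sin(\alpha\pi)}{\pi}$. Let $H^1_L(0,1)=\{u\in H^1(0,1):u(0)=0\}$. $\mathcal H=H^1_L(0,1)\times L^2(0,1)\times H^1_0(0,1)\times L^2(0,1)\times L^2(\mathbb R)$ with inner product $\langle(u,v,y,z,\omega),(\tilde u,\tilde v,\tilde y,\tilde z,\tilde\omega)\rangle_{\mathcal H}=\int_0^1(v\bar{\tilde v}+u_x\bar{\tilde u}_x+z\bar{\tilde z}+a y_x\bar{\tilde y}_x)dx+\gamma\kappa(\alpha)\int_{\mathbb R}\omega\bar{\tilde\omega}\,d\xi$. $D(\mathcal A)$ is the set of $(u,v,y,z,\omega)\in\mathcal H$ with $u\in H^2(0,1)\cap H^1_L(0,1)$, $y\in H^2(0,1)\cap H^1_0(0,1)$, $v\in H^1_L(0,1)$, $z\in H^1_0(0,1)$, $-(\xi^2+\eta)\omega+v(1)\mu(\xi)\in L^2(\mathbb R)$, $|\xi|\omega\in L^2(\mathbb R)$, $u_x(1)+\gamma\kappa(\alpha)\int_{\mathbb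 R}\mu(\xi)\omega(\xi)d\xi=0$, and $\mathcal A(u,v,y,z,\omega)=(v,\,u_{xx}-bz,\,z,\,ay_{xx}+bv,\,-(\xi^2+\eta)\omega+v(1)\mu(\xi))$; $\mathcal A$ generates a $C_0$-semigroup of contractions $e^{t\mathcal A}$ on $\mathcal H$. *)

theory Defs
  imports "HOL-Analysis.Analysis"
begin

text \<open>Functions are complex valued; an element of L2 is represented by a function.\<close>

definition L2 :: "real set \<Rightarrow> (real \<Rightarrow> complex) \<Rightarrow> bool" where
  "L2 S f \<longleftrightarrow> f \<in> borel_measurable (lebesgue_on S) \<and>
      integrable (lebesgue_on S) (\<lambda>x. (cmod (f x))^2)"

definition sqn :: "real set \<Rightarrow> (real \<Rightarrow> complex) \<Rightarrow> real" where
  "sqn S f = (LINT x | lebesgue_on S. (cmod (f x))^2)"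

text \<open>g is the weak derivative of u on (0,1), u being its continuous representative
  (u(x) = u(0) + int_0^x g on [0,1], g in L2(0,1)).\<close>
definition wderiv :: "(real \<Rightarrow> complex) \<Rightarrow> (real \<Rightarrow> complex) \<Rightarrow> bool" where
  "wderiv u g \<longleftrightarrow> L2 {0..1} g \<and> (\<forall>x\<in>{0..1}. u x = u 0 + integral {0..x} g)"

definition H1 :: "(real \<Rightarrow> complex) \<Rightarrow> bool" where
  "H1 u \<longleftrightarrow> L2 {0..1} u \<and> (\<exists>g. wderiv u g)"

definition H2 :: "(real \<Rightarrow> complex) \<Rightarrow> bool" where
  "H2 u \<longleftrightarrow> L2 {0..1} u \<and> (\<exists>g. wderiv u g \<and> H1 g)"

definition dx :: "(real \<Rightarrow> complex) \<Rightarrow> (real \<Rightarrow> complex)" where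
  "dx u = (SOME g. wderiv u g)"

definition mu :: "real \<Rightarrow> real \<Rightarrow> real" where
  "mu \<alpha> \<xi> = \<bar>\<xi>\<bar> powr ((2 * \<alpha> - 1) / 2)"

definition kappa :: "real \<Rightarrow> real" where
  "kappa \<alpha> = sin (\<alpha> * pi) / pi"

type_synonym st = "(real \<Rightarrow> complex) \<times> (real \<Rightarrow> complex) \<times> (real \<Rightarrow> complex)
                   \<times> (real \<Rightarrow> complex) \<times> (real \<Rightarrow> complex)"

fun st_sub :: "st \<Rightarrow> st \<Rightarrow> st" where
  "st_sub (u1, v1, y1, z1, w1) (u2, v2, y2, z2, w2) =
     (\<lambda>x. u1 x - u2 x, \<lambda>x. v1 x - v2 x, \<lambda>x. y1 x - y2 x, \<lambda>x. z1 x - z2 x, \<lambda>x. w1 x - w2 x)"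

fun st_scale :: "complex \<Rightarrow> st \<Rightarrow> st" where
  "st_scale c (u, v, y, z, w) = (\<lambda>x. c * u x, \<lambda>x. c * v x, \<lambda>x. c * y x, \<lambda>x. c * z x, \<lambda>x. c * w x)"

fun inH :: "st \<Rightarrow> bool" where
  "inH (u, v, y, z, w) \<longleftrightarrow> H1 u \<and> u 0 = 0 \<and> L2 {0..1} v \<and> H1 y \<and> y 0 = 0 \<and> y 1 = 0
     \<and> L2 {0..1} z \<and> L2 UNIV w"

fun energy :: "real \<Rightarrow> real \<Rightarrow> st \<Rightarrow> real" where
  "energy \<alpha> \<gamma> (u, v, y, z, w) =
     sqn {0..1} v + sqn {0..1} (dx u) + sqn {0..1} z + sqn {0..1} (dx y)
     + \<gamma> * kappa \<alpha> * sqn UNIV w"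

definition normH :: "real \<Rightarrow> real \<Rightarrow> st \<Rightarrow> real" where
  "normH \<alpha> \<gamma> U = sqrt (energy \<alpha> \<gamma> U)"

fun inDA :: "real \<Rightarrow> real \<Rightarrow> real \<Rightarrow> st \<Rightarrow> bool" where
  "inDA \<alpha> \<eta> \<gamma> (u, v, y, z, w) \<longleftrightarrow> inH (u, v, y, z, w) \<and>
     H2 u \<and> H2 y \<and> H1 v \<and> v 0 = 0 \<and> H1 z \<and> z 0 = 0 \<and> z 1 = 0 \<and>
     L2 UNIV (\<lambda>\<xi>. - complex_of_real (\<xi>^2 + \<eta>) * w \<xi> + v 1 * complex_of_real (mu \<alpha> \<xi>)) \<and>
     L2 UNIV (\<lambda>\<xi>. complex_of_real \<bar>\<xi>\<bar> * w \<xi>) \<and>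
     integrable lborel (\<lambda>\<xi>. complex_of_real (mu \<alpha> \<xi>) * w \<xi>) \<and>
     (\<exists>g h. wderiv u g \<and> wderiv g h \<and>
        g 1 + complex_of_real (\<gamma> * kappa \<alpha>) * (LINT \<xi>|lborel. complex_of_real (mu \<alpha> \<xi>) * w \<xi>) = 0)"

text \<open>W is (a representative of) A U, with a = 1.\<close>
fun Ahas :: "real \<Rightarrow> real \<Rightarrow> real \<Rightarrow> st \<Rightarrow> st \<Rightarrow> bool" where
  "Ahas \<alpha> \<eta> b (u, v, y, z, w) W \<longleftrightarrow>
     (\<exists>u1 u2 y1 y2. wderiv u u1 \<and> wderiv u1 u2 \<and> wderiv y y1 \<and> wderiv y1 y2 \<and>
        W = (v, \<lambda>x. u2 x - complex_of_real b * z x, z, \<lambda>x. y2 x + complex_of_real b * v x,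
             \<lambda>\<xi>. - complex_of_real (\<xi>^2 + \<eta>) * w \<xi> + v 1 * complex_of_real (mu \<alpha> \<xi>)))"

text \<open>Classical solution U in C^1([0,oo); H) of U' = A U with U(t) in D(A); these are
  exactly the orbits t \<mapsto> e^{tA} U0 with U0 in D(A).\<close>
definition classical_solution :: "real \<Rightarrow> real \<Rightarrow> real \<Rightarrow> real \<Rightarrow> (real \<Rightarrow> st) \<Rightarrow> bool" where
  "classical_solution \<alpha> \<eta> \<gamma> b U \<longleftrightarrow>
     (\<forall>t\<ge>0. inDA \<alpha> \<eta> \<gamma> (U t) \<and>
        (\<exists>W. Ahas \<alpha> \<eta> b (U t) W \<and>
           ((\<lambda>h. normH \<alpha> \<gamma> (st_sub (st_scale (complex_of_real (1 / h)) (st_sub (U (t + h)) (U t))) W))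
              \<longlongrightarrow> 0) (at 0 within {h. t + h \<ge> 0})))"

text \<open>Uniform (exponential) stability of e^{tA}: ||e^{tA}U0|| <= M e^{-\<omega> t} ||U0||,
  tested on the dense set D(A) of initial data.\<close>
definition unif_exp_stable :: "real \<Rightarrow> real \<Rightarrow> real \<Rightarrow> real \<Rightarrow> bool" where
  "unif_exp_stable \<alpha> \<eta> \<gamma> b \<longleftrightarrow>
     (\<exists>M \<omega>. \<omega> > 0 \<and> (\<forall>U. classical_solution \<alpha> \<eta> \<gamma> b U \<longrightarrow>
        (\<forall>t\<ge>0. normH \<alpha> \<gamma> (U t) \<le> M * exp (- \<omega> * t) * normH \<alpha> \<gamma> (U 0))))"

end

theory Submission
  imports Defs
begin

text \<open>An eigenvector of the generator with eigenvalue \<open>l\<close> gives a classical solution whose norm is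
  proportional to \<open>exp (Re l * t)\<close>, so it suffices to find eigenvalues with real part arbitrarily
  close to \<open>0\<close>. With \<open>r1\<^sup>2 = l\<^sup>2 - \<i> b l\<close>, \<open>r2\<^sup>2 = l\<^sup>2 + \<i> b l\<close> and
  \<open>K(l) = \<integral> \<mu>(\<xi>)\<^sup>2 / (\<xi>\<^sup>2 + \<eta> + l) d\<xi>\<close>, a number \<open>l\<close> is an eigenvalue as soon as
  \<open>r1 cosh r1 sinh r2 + r2 cosh r2 sinh r1 + 2 \<gamma> \<kappa>(\<alpha>) l K(l) sinh r1 sinh r2 = 0\<close>. Since \<open>K(l)\<close>
  tends to \<open>0\<close> high up the imaginary axis, this function divided by \<open>l\<close> and evaluated at
  \<open>l = z + 2 \<pi> n \<i>\<close> converges to \<open>sinh (2 z)\<close>, uniformly for small \<open>z\<close>. The simple zero of the limit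
  at \<open>0\<close> persists for large \<open>n\<close> by Brouwer's fixed point theorem, for which continuity suffices.\<close>

subsection \<open>Weak derivatives and the energy norm\<close>

lemma L2_continuous:
  assumes "continuous_on {0..1} f"
  shows "L2 {0..1} f"
  unfolding L2_def
proof
  show "f \<in> borel_measurable (lebesgue_on {0..1})"
    using assms by (rule continuous_imp_measurable_on_sets_lebesgue) simp
  show "integrable (lebesgue_on {0..1}) (\<lambda>x. (cmod (f x))\<^sup>2)"
    by (intro continuous_imp_integrable_real continuous_intros assms)
qed

text \<open>A bounded interval has finite measure, so square integrability gives integrability. This
  connects \<open>L2\<close>, a Lebesgue notion, with the Henstock-Kurzweil \<open>integral\<close>
  in \<open>wderiv\<close>.\<close>

lemma L2_imp_integrable_on:
  assumes "L2 {0..1} g"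
  shows "g integrable_on {0..1}"
proof -
  have [measurable]: "g \<in> borel_measurable (lebesgue_on {0..1})"
    and 1: "integrable (lebesgue_on {0..1}) (\<lambda>x. (cmod (g x))^2)"
    using assms by (auto simp: L2_def)
  interpret finite_measure "lebesgue_on {0..1::real}"
    by (rule finite_measureI) (simp add: emeasure_restrict_space)
  have "integrable (lebesgue_on {0..1}) (\<lambda>x. (g x)^2)"
    by (rule Bochner_Integration.integrable_bound[OF 1]) (auto simp: norm_power)
  then have "integrable (lebesgue_on {0..1}) g"
    by (rule square_integrable_imp_integrable[rotated]) simp
  then show ?thesis
    by (rule integrable_on_lebesgue_on) simp
qed

text \<open>Lebesgue differentiation: almost every value of an integrable function is the limit of
  its averages over short intervals to its right, and here all these averages vanish.\<close>

lemma AE_zero_of_integral_zero: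
  fixes d :: "real \<Rightarrow> complex"
  assumes int: "d integrable_on {0..1}" and zero: "\<And>x. x \<in> {0..1} \<Longrightarrow> integral {0..x} d = 0"
  shows "AE x in lebesgue_on {0..1}. d x = 0"
proof -
  \<comment> \<open>Extension by zero makes the function integrable over every interval, so the
    differentiation theorem on the whole line applies.\<close>
  define e where "e = (\<lambda>x. if x \<in> {0..1} then d x else 0)"
  have eU: "e integrable_on UNIV"
    unfolding e_def using int by (simp only: integrable_restrict_UNIV)
  then have ei: "e integrable_on cbox a b" for a b
    by (rule integrable_on_subcbox) auto
  have up: "integral {a..b} e = 0" if "a \<le> 0" for a b
  proof -
    have *: "e integrable_on {a..b}" using ei[of a b] by simp
    have "integral {a..b} e = integral ({a..b} \<inter> {0..1}) d"
      unfolding e_def by (metis Int_commute integral_restrict_Int)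
    also have "{a..b} \<inter> {0..1} = {0..min b 1}" using that by auto
    also have "integral {0..min b 1} d = 0"
      by (cases "b \<ge> 0") (auto intro: zero)
    finally show ?thesis .
  qed
  have all0: "integral {x..y} e = 0" if "x \<le> y" for x y
  proof (cases "x \<le> 0")
    case False
    have "integral {0..x} e + integral {x..y} e = integral {0..y} e"
      using False that ei[of 0 y] by (intro Henstock_Kurzweil_Integration.integral_combine) auto
    then show ?thesis using up by simp
  qed (use up in simp)
  obtain N where N: "negligible N"
    "\<And>x \<epsilon>. \<lbrakk>x \<notin> N; 0 < \<epsilon>\<rbrakk> \<Longrightarrow> \<exists>\<delta>>0. \<forall>h. 0 < h \<and> h < \<delta> \<longrightarrow>
        norm (integral (cbox x (x + h *\<^sub>R One)) e /\<^sub>R h ^ DIM(real) - e x) < \<epsilon>"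
    by (rule integrable_ccontinuous_explicit[of e, OF ei]) (rule that)
  have e0: "e x = 0" if xN: "x \<notin> N" for x
  proof (rule ccontr)
    assume "e x \<noteq> 0"
    then obtain \<delta> where "\<delta> > 0" and \<delta>: "\<And>h. 0 < h \<Longrightarrow> h < \<delta> \<Longrightarrow>
        norm (integral (cbox x (x + h *\<^sub>R One)) e /\<^sub>R h ^ DIM(real) - e x) < norm (e x)"
      using N(2)[OF xN, of "norm (e x)"] by auto
    then show False
      using \<delta>[of "\<delta>/2"] all0[of x "x + \<delta>/2"] by simp
  qed
  have "AE x in lebesgue. x \<notin> N"
    using N(1) by (auto simp: negligible_iff_null_sets intro: AE_not_in)
  then have "AE x in lebesgue. x \<in> {0..1} \<longrightarrow> d x = 0"
  proof eventually_elim
    case (elim x)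
    then show ?case using e0[of x] by (auto simp: e_def)
  qed
  then show ?thesis
    by (subst AE_restrict_space_iff) auto
qed

text \<open>\<open>dx u\<close> is an arbitrary choice among weak derivatives, so
  \<open>energy\<close> can be computed only if the choice does not matter. Equal primitives force
  equality almost everywhere, which suffices for the integral.\<close>

lemma wderiv_sqn_unique:
  assumes "wderiv u g" and "wderiv u h"
  shows "sqn {0..1} g = sqn {0..1} h"
proof -
  have L: "L2 {0..1} g" "L2 {0..1} h"
    using assms by (simp_all only: wderiv_def)
  have eq: "integral {0..x} g = integral {0..x} h" if "x \<in> {0..1}" for x
    using assms that unfolding wderiv_def by (metis add_left_cancel)
  note I = L[THEN L2_imp_integrable_on]
  have "AE x in lebesgue_on {0..1}. g x - h x = 0"
  proof (rule AE_zero_of_integral_zero)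
    show "(\<lambda>x. g x - h x) integrable_on {0..1}"
      using I by (rule integrable_diff)
    fix x :: real assume x: "x \<in> {0..1}"
    then have "g integrable_on {0..x}" "h integrable_on {0..x}"
      using I by (auto intro: integrable_on_subinterval)
    then show "integral {0..x} (\<lambda>x. g x - h x) = 0"
      using eq[OF x] by (simp add: Henstock_Kurzweil_Integration.integral_diff)
  qed
  then have "AE x in lebesgue_on {0..1}. (cmod (g x))\<^sup>2 = (cmod (h x))\<^sup>2"
    by eventually_elim auto
  then show ?thesis
    unfolding sqn_def by (rule integral_cong_AE[rotated 2]) (use L in \<open>auto simp: L2_def\<close>)
qed

lemma sqn_dx: "wderiv u g \<Longrightarrow> sqn {0..1} (dx u) = sqn {0..1} g"
  unfolding dx_def by (metis someI wderiv_sqn_unique)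

lemma wderiv_if_has_derivative:
  assumes "\<And>x. (u has_vector_derivative g x) (at x)" and "continuous_on {0..1} g"
  shows "wderiv u g"
  unfolding wderiv_def
proof (intro conjI ballI)
  show "L2 {0..1} g" by (rule L2_continuous) fact
  fix x :: real assume "x \<in> {0..1}"
  then have "(g has_integral (u x - u 0)) {0..x}"
    by (intro fundamental_theorem_of_calculus) (auto intro: has_vector_derivative_at_within assms(1))
  then show "u x = u 0 + integral {0..x} g"
    by (simp add: integral_unique)
qed

section \<open>Homogeneity and positivity of the energy norm\<close>

lemma sqn_cmult: "sqn S (\<lambda>x. c * f x) = (cmod c)\<^sup>2 * sqn S f"
  by (simp add: sqn_def norm_mult power_mult_distrib)

lemma wderiv_cmult:
  assumes "wderiv u g"
  shows "wderiv (\<lambda>x. c * u x) (\<lambda>x. c * g x)"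
  unfolding wderiv_def
proof (intro conjI ballI)
  show "L2 {0..1} (\<lambda>x. c * g x)"
    using assms[unfolded wderiv_def, THEN conjunct1]
    by (auto simp: L2_def norm_mult power_mult_distrib)
  fix x :: real assume "x \<in> {0..1}"
  with assms have "u x = u 0 + integral {0..x} g"
    by (simp only: wderiv_def)
  then show "c * u x = c * u 0 + integral {0..x} (\<lambda>x. c * g x)"
    by (metis distrib_left integral_mult_right)
qed

text \<open>\<open>dx\<close> of a scaled function is a fresh choice; passing to explicit weak
  derivatives removes this ambiguity.\<close>

lemma energy_scale:
  assumes "wderiv u g" and "wderiv y h"
  shows "energy \<alpha> \<gamma> (st_scale c (u, v, y, z, w)) = (cmod c)\<^sup>2 * energy \<alpha> \<gamma> (u, v, y, z, w)"
  using sqn_dx[OF assms(1)] sqn_dx[OF assms(2)]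
    sqn_dx[OF wderiv_cmult[OF assms(1)]] sqn_dx[OF wderiv_cmult[OF assms(2)]]
  by (simp add: sqn_cmult algebra_simps)

lemma normH_scale:
  assumes "wderiv u g" and "wderiv y h"
  shows "normH \<alpha> \<gamma> (st_scale c (u, v, y, z, w)) = cmod c * normH \<alpha> \<gamma> (u, v, y, z, w)"
  unfolding normH_def energy_scale[OF assms] by (simp add: real_sqrt_mult)

lemma sqn_nonneg: "sqn S f \<ge> 0"
  by (simp add: sqn_def)

lemma sqn_pos:
  assumes "continuous_on {0..1} f" and "x \<in> {0..1}" and "f x \<noteq> 0"
  shows "sqn {0..1} f > 0"
proof -
  have "sqn {0..1} f = 0 \<longleftrightarrow> (\<forall>x\<in>{0..1}. (cmod (f x))\<^sup>2 = 0)"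
    unfolding sqn_def by (rule integralL_eq_0_iff) (auto intro!: continuous_intros assms)
  with assms(2,3) sqn_nonneg[of "{0..1}" f] show ?thesis by force
qed

lemma kappa_pos: "0 < \<alpha> \<Longrightarrow> \<alpha> < 1 \<Longrightarrow> kappa \<alpha> > 0"
  unfolding kappa_def by (intro divide_pos_pos sin_gt_zero) auto

text \<open>No term of the energy is negative, and a continuous derivative that is nonzero at 0
  contributes a positive integral.\<close>

lemma normH_pos:
  assumes "wderiv u g" and "wderiv y h" and "\<gamma> > 0" and "0 < \<alpha>" and "\<alpha> < 1"
    and "continuous_on {0..1} g" and "continuous_on {0..1} h" and "g 0 \<noteq> 0 \<or> h 0 \<noteq> 0"
  shows "normH \<alpha> \<gamma> (u, v, y, z, w) > 0"
proof -
  have "sqn {0..1} g > 0 \<or> sqn {0..1} h > 0"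
    using assms(6-8) sqn_pos[of g 0] sqn_pos[of h 0] by auto
  moreover have "\<gamma> * kappa \<alpha> * sqn UNIV w \<ge> 0"
    using assms(3-5) kappa_pos by (intro mult_nonneg_nonneg) (auto simp: sqn_nonneg less_imp_le)
  ultimately show ?thesis
    using sqn_nonneg[of "{0..1}" g] sqn_nonneg[of "{0..1}" h]
      sqn_nonneg[of "{0..1}" v] sqn_nonneg[of "{0..1}" z]
    by (simp add: normH_def sqn_dx[OF assms(1)] sqn_dx[OF assms(2)], linarith)
qed

subsection \<open>The kernel of the diffusive representation\<close>

lemma mu_square: "(mu \<alpha> \<xi>)\<^sup>2 = \<bar>\<xi>\<bar> powr (2 * \<alpha> - 1)"
  unfolding mu_def power2_eq_square powr_add[symmetric] by (rule arg_cong[where f = "(powr) \<bar>\<xi>\<bar>"]) (simp add: field_simps)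

lemma mu_measurable [measurable]: "mu \<alpha> \<in> borel_measurable borel"
  unfolding mu_def[abs_def] by measurable

text \<open>Near 0 the integrand is of order |\<xi>|^(2\<alpha>-1), integrable because \<alpha> > 0;
  at infinity it is of order |\<xi>|^(2\<alpha>-3), integrable because \<alpha> < 1.\<close>

lemma integrable_mu_square:
  assumes "0 < \<alpha>" and "\<alpha> < 1" and "c > 0"
  shows "integrable lborel (\<lambda>\<xi>. (mu \<alpha> \<xi>)\<^sup>2 / (\<xi>\<^sup>2 + c))"
proof -
  \<comment> \<open>A majorant on the positive half-line only: \<xi>^2 is dropped from the
    denominator up to 1, and \<open>c\<close> beyond 1. Adding the reflection \<open>f (- x)\<close>
    covers the negative half-line.\<close>
  define f where "f = (\<lambda>\<xi>::real. indicator {0..1} \<xi> * (\<xi> powr (2 * \<alpha> - 1) / c)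
      + indicator {1..} \<xi> * \<xi> powr (2 * \<alpha> - 3))"
  have "(\<lambda>\<xi>. \<xi> powr (2 * \<alpha> - 1) / c) integrable_on {0..1}"
    using integrable_on_powr_from_0[of "2 * \<alpha> - 1" 1] assms by (intro integrable_on_divide) auto
  then have 1: "set_integrable lebesgue {0..1} (\<lambda>\<xi>. \<xi> powr (2 * \<alpha> - 1) / c)"
    by (rule nonnegative_absolutely_integrable_1) (use assms in auto)
  have "(\<lambda>\<xi>. \<xi> powr (2 * \<alpha> - 3)) integrable_on {1..}"
    using has_integral_powr_to_inf[of "2 * \<alpha> - 3" 1] assms by (auto simp: integrable_on_def)
  then have 2: "set_integrable lebesgue {1..} (\<lambda>\<xi>. \<xi> powr (2 * \<alpha> - 3))"
    by (rule nonnegative_absolutely_integrable_1) auto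
  have [measurable]: "f \<in> borel_measurable borel"
    unfolding f_def by measurable
  have "integrable lebesgue f"
    using Bochner_Integration.integrable_add[OF 1[unfolded set_integrable_def] 2[unfolded set_integrable_def]]
    by (simp add: f_def)
  then have f: "integrable lborel f"
    by (subst (asm) integrable_completion) auto
  then have "integrable lborel (\<lambda>x. f (0 + (-1) * x))"
    by (rule lborel_integrable_real_affine) auto
  with f have sum: "integrable lborel (\<lambda>x. f x + f (- x))"
    by (intro Bochner_Integration.integrable_add) auto
  have f0: "f x \<ge> 0" for x
    using assms by (auto simp: f_def)
  have bound: "\<bar>\<xi>\<bar> powr (2 * \<alpha> - 1) / (\<xi>\<^sup>2 + c) \<le> f \<bar>\<xi>\<bar>" for \<xi>
  proof (cases "\<bar>\<xi>\<bar> \<le> 1")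
    case True
    have "\<bar>\<xi>\<bar> powr (2 * \<alpha> - 1) / (\<xi>\<^sup>2 + c) \<le> \<bar>\<xi>\<bar> powr (2 * \<alpha> - 1) / c"
      using assms by (intro divide_left_mono) (auto intro!: mult_pos_pos add_nonneg_pos)
    also have "\<dots> \<le> f \<bar>\<xi>\<bar>"
      using True by (simp add: f_def)
    finally show ?thesis .
  next
    case False
    then have "0 < \<xi>\<^sup>2" by auto
    then have "\<bar>\<xi>\<bar> powr (2 * \<alpha> - 1) / (\<xi>\<^sup>2 + c) \<le> \<bar>\<xi>\<bar> powr (2 * \<alpha> - 1) / \<xi>\<^sup>2"
      using assms by (intro divide_left_mono mult_pos_pos add_pos_pos) auto
    also have "\<dots> = \<bar>\<xi>\<bar> powr (2 * \<alpha> - 1) / \<bar>\<xi>\<bar> powr 2"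
      using False by (simp add: powr_numeral)
    also have "\<dots> = \<bar>\<xi>\<bar> powr (2 * \<alpha> - 3)"
      unfolding powr_diff[symmetric] by simp
    also have "\<dots> = f \<bar>\<xi>\<bar>"
      using False by (simp add: f_def)
    finally show ?thesis .
  qed
  have "\<bar>\<xi>\<bar> powr (2 * \<alpha> - 1) / (\<xi>\<^sup>2 + c) \<le> f \<xi> + f (- \<xi>)" for \<xi>
    using bound[of \<xi>] f0[of \<xi>] f0[of "- \<xi>"] by (cases "\<xi> \<ge> 0") auto
  then show ?thesis
    unfolding mu_square using assms
    by (intro Bochner_Integration.integrable_bound[OF sum]) (auto simp: f0 intro!: AE_I2)
qed

text \<open>The function \<open>diffK \<alpha> \<eta>\<close> is \<open>\<pi> / sin (\<alpha> \<pi>) * (l + \<eta>) powr (\<alpha> - 1)\<close>; only its continuity and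
  its decay along the imaginary axis matter below.\<close>

definition diffK :: "real \<Rightarrow> real \<Rightarrow> complex \<Rightarrow> complex" where
  "diffK \<alpha> \<eta> l =
     (LINT \<xi>|lborel. complex_of_real ((mu \<alpha> \<xi>)\<^sup>2) / (complex_of_real (\<xi>\<^sup>2 + \<eta>) + l))"

text \<open>Half of \<eta> absorbs a negative real part of \<open>l\<close>; the other half keeps
  the denominator away from 0. The bound is independent of \<open>l\<close>, so it yields a common
  majorant for dominated convergence.\<close>

lemma denom_ge_Re:
  assumes "Re l \<ge> - \<eta> / 2"
  shows "cmod (complex_of_real (\<xi>\<^sup>2 + \<eta>) + l) \<ge> \<xi>\<^sup>2 + \<eta> / 2"
proof -
  have "\<xi>\<^sup>2 + \<eta> / 2 \<le> Re (complex_of_real (\<xi>\<^sup>2 + \<eta>) + l)" using assms by simp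
  also have "\<dots> \<le> cmod (complex_of_real (\<xi>\<^sup>2 + \<eta>) + l)" by (rule complex_Re_le_cmod)
  finally show ?thesis .
qed

lemma denom_ge_Im: "cmod (complex_of_real (\<xi>\<^sup>2 + \<eta>) + l) \<ge> \<bar>Im l\<bar>"
  using abs_Im_le_cmod[of "complex_of_real (\<xi>\<^sup>2 + \<eta>) + l"] by simp

lemma denom_nonzero:
  assumes "\<eta> > 0" and "Re l \<ge> - \<eta> / 2"
  shows "complex_of_real (\<xi>\<^sup>2 + \<eta>) + l \<noteq> 0"
proof -
  have "0 < \<xi>\<^sup>2 + \<eta> / 2" using assms by (intro add_nonneg_pos) auto
  with denom_ge_Re[OF assms(2), of \<xi>] show ?thesis by force
qed

lemma diffK_integrand_bound:
  assumes "\<eta> > 0" and "Re l \<ge> - \<eta> / 2"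
  shows "cmod (complex_of_real ((mu \<alpha> \<xi>)\<^sup>2) / (complex_of_real (\<xi>\<^sup>2 + \<eta>) + l))
     \<le> (mu \<alpha> \<xi>)\<^sup>2 / (\<xi>\<^sup>2 + \<eta> / 2)"
proof -
  have pos: "0 < \<xi>\<^sup>2 + \<eta> / 2" using assms by (intro add_nonneg_pos) auto
  have "(mu \<alpha> \<xi>)\<^sup>2 / cmod (complex_of_real (\<xi>\<^sup>2 + \<eta>) + l) \<le> (mu \<alpha> \<xi>)\<^sup>2 / (\<xi>\<^sup>2 + \<eta> / 2)"
    using pos less_le_trans[OF pos denom_ge_Re[OF assms(2)]] denom_ge_Re[OF assms(2), of \<xi>]
    by (intro divide_left_mono mult_pos_pos) simp_all
  then show ?thesis by (simp add: norm_divide norm_power)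
qed

lemma diffK_integrable:
  assumes "0 < \<alpha>" and "\<alpha> < 1" and "\<eta> > 0" and "Re l \<ge> - \<eta> / 2"
  shows "integrable lborel (\<lambda>\<xi>. complex_of_real ((mu \<alpha> \<xi>)\<^sup>2) / (complex_of_real (\<xi>\<^sup>2 + \<eta>) + l))"
  using assms diffK_integrand_bound[OF assms(3,4)]
  by (intro Bochner_Integration.integrable_bound[OF integrable_mu_square[of \<alpha> "\<eta> / 2"]])
    (auto intro!: AE_I2 intro: order_trans[OF _ abs_ge_self])

text \<open>Dominated convergence with the majorant from \<open>diffK_integrand_bound\<close>, which
  does not depend on \<open>l\<close>.\<close>

lemma diffK_continuous:
  assumes "0 < \<alpha>" and "\<alpha> < 1" and "\<eta> > 0"
  shows "continuous_on {l. Re l \<ge> - \<eta> / 2} (diffK \<alpha> \<eta>)"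
proof (rule continuous_on_sequentiallyI)
  fix l :: "nat \<Rightarrow> complex" and l0
  assume l: "\<forall>n. l n \<in> {l. Re l \<ge> - \<eta> / 2}" "l0 \<in> {l. Re l \<ge> - \<eta> / 2}" and lim: "l \<longlonglongrightarrow> l0"
  show "(\<lambda>n. diffK \<alpha> \<eta> (l n)) \<longlonglongrightarrow> diffK \<alpha> \<eta> l0"
    unfolding diffK_def
  proof (rule integral_dominated_convergence[where w = "\<lambda>\<xi>. (mu \<alpha> \<xi>)\<^sup>2 / (\<xi>\<^sup>2 + \<eta> / 2)"])
    show "integrable lborel (\<lambda>\<xi>. (mu \<alpha> \<xi>)\<^sup>2 / (\<xi>\<^sup>2 + \<eta> / 2))"
      using assms by (intro integrable_mu_square) auto
    show "AE \<xi> in lborel. (\<lambda>n. complex_of_real ((mu \<alpha> \<xi>)\<^sup>2) / (complex_of_real (\<xi>\<^sup>2 + \<eta>) + l n))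
        \<longlonglongrightarrow> complex_of_real ((mu \<alpha> \<xi>)\<^sup>2) / (complex_of_real (\<xi>\<^sup>2 + \<eta>) + l0)"
      using denom_nonzero[OF assms(3)] l by (intro AE_I2 tendsto_intros lim) auto
    show "AE \<xi> in lborel. cmod (complex_of_real ((mu \<alpha> \<xi>)\<^sup>2) / (complex_of_real (\<xi>\<^sup>2 + \<eta>) + l n))
        \<le> (mu \<alpha> \<xi>)\<^sup>2 / (\<xi>\<^sup>2 + \<eta> / 2)" for n
      using l by (intro AE_I2 diffK_integrand_bound assms) auto
  qed auto
qed

text \<open>Dominated convergence concerns sequences, so the uniform statement is proved by
  contradiction: a failure yields points with imaginary parts tending to infinity along which the
  integrand tends to 0 pointwise under the same majorant.\<close>

lemma diffK_decay:
  assumes "0 < \<alpha>" and "\<alpha> < 1" and "\<eta> > 0" and "e > 0"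
  shows "\<exists>R. \<forall>l. Re l \<ge> - \<eta> / 2 \<and> Im l \<ge> R \<longrightarrow> cmod (diffK \<alpha> \<eta> l) < e"
proof (rule ccontr)
  assume "\<not> ?thesis"
  then have "\<forall>n::nat. \<exists>l. Re l \<ge> - \<eta> / 2 \<and> Im l \<ge> real n \<and> cmod (diffK \<alpha> \<eta> l) \<ge> e"
    by (meson not_less)
  then obtain l where l: "\<And>n. Re (l n) \<ge> - \<eta> / 2" "\<And>n. Im (l n) \<ge> real n"
    "\<And>n. cmod (diffK \<alpha> \<eta> (l n)) \<ge> e" by metis
  have "(\<lambda>n. diffK \<alpha> \<eta> (l n)) \<longlonglongrightarrow> (LINT \<xi>::real|lborel. (0::complex))"
    unfolding diffK_def
  proof (rule integral_dominated_convergence[where w = "\<lambda>\<xi>. (mu \<alpha> \<xi>)\<^sup>2 / (\<xi>\<^sup>2 + \<eta> / 2)"])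
    show "integrable lborel (\<lambda>\<xi>. (mu \<alpha> \<xi>)\<^sup>2 / (\<xi>\<^sup>2 + \<eta> / 2))"
      using assms by (intro integrable_mu_square) auto
    have inf: "filterlim (\<lambda>n. complex_of_real (\<xi>\<^sup>2 + \<eta>) + l n) at_infinity sequentially" for \<xi>
    proof (rule filterlim_norm_at_top_imp_at_infinity)
      show "filterlim (\<lambda>n. cmod (complex_of_real (\<xi>\<^sup>2 + \<eta>) + l n)) at_top sequentially"
        by (rule filterlim_at_top_mono[OF filterlim_real_sequentially])
          (intro always_eventually allI order_trans[OF l(2) order_trans[OF abs_ge_self denom_ge_Im]])
    qed
    show "AE \<xi> in lborel. (\<lambda>n. complex_of_real ((mu \<alpha> \<xi>)\<^sup>2) / (complex_of_real (\<xi>\<^sup>2 + \<eta>) + l n)) \<longlonglongrightarrow> 0"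
      by (intro AE_I2 tendsto_divide_0[OF tendsto_const inf])
    show "AE \<xi> in lborel. cmod (complex_of_real ((mu \<alpha> \<xi>)\<^sup>2) / (complex_of_real (\<xi>\<^sup>2 + \<eta>) + l n))
        \<le> (mu \<alpha> \<xi>)\<^sup>2 / (\<xi>\<^sup>2 + \<eta> / 2)" for n
      using l by (intro AE_I2 diffK_integrand_bound assms) auto
  qed auto
  then have "(\<lambda>n. cmod (diffK \<alpha> \<eta> (l n))) \<longlonglongrightarrow> 0"
    by (simp add: tendsto_norm_zero_iff)
  then have "e \<le> 0"
    by (rule tendsto_lowerbound) (auto simp: l(3))
  with \<open>e > 0\<close> show False by simp
qed

subsection \<open>High-frequency roots of the characteristic equation\<close>

text \<open>The translation is a multiple of the period 2 pi i of \<open>sinh\<close> and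
  \<open>cosh\<close>, so it moves the search to high frequency without changing them.\<close>

definition shift :: "nat \<Rightarrow> complex \<Rightarrow> complex" where
  "shift n z = z + of_real (2 * pi * real n) * \<i>"

text \<open>The principal branch is essential: its real part is nonnegative, which keeps
  \<open>ratio \<beta> l + 1\<close> away from 0, and it tends to 1 (not -1) as \<open>l\<close>
  grows.\<close>

definition ratio :: "complex \<Rightarrow> complex \<Rightarrow> complex" where
  "ratio \<beta> l = csqrt (1 + \<beta> / l)"

text \<open>The root \<open>l * ratio \<beta> l\<close> of \<open>l\<^sup>2 + \<beta> l\<close>, at \<open>l = shift n z\<close>, without its part \<open>2 \<pi> n \<i>\<close>.\<close>
definition shifted_root :: "complex \<Rightarrow> nat \<Rightarrow> complex \<Rightarrow> complex" where
  "shifted_root \<beta> n z = z + \<beta> / (ratio \<beta> (shift n z) + 1)"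

lemma Re_one_plus_pos: "cmod w < 1 \<Longrightarrow> Re (1 + w) > 0"
  using abs_Re_le_cmod[of w] by simp

lemma ratio_plus_one_ge: "cmod (ratio \<beta> l + 1) \<ge> 1"
proof -
  have "1 \<le> Re (ratio \<beta> l + 1)"
    using Re_csqrt[of "1 + \<beta> / l"] unfolding ratio_def plus_complex.sel one_complex.sel by linarith
  also have "\<dots> \<le> cmod (ratio \<beta> l + 1)" by (rule complex_Re_le_cmod)
  finally show ?thesis .
qed

lemma ratio_plus_one_nonzero: "ratio \<beta> l + 1 \<noteq> 0"
  using ratio_plus_one_ge[of \<beta> l] by auto

text \<open>Multiplication by the conjugate factor \<open>ratio \<beta> l + 1\<close> removes the
  square root and exposes the order 1/l of the difference.\<close>

lemma ratio_minus_one: "ratio \<beta> l - 1 = (\<beta> / l) / (ratio \<beta> l + 1)"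
proof -
  have "(ratio \<beta> l - 1) * (ratio \<beta> l + 1) = (ratio \<beta> l)\<^sup>2 - 1"
    by (simp add: power2_eq_square algebra_simps)
  also have "\<dots> = \<beta> / l" by (simp add: ratio_def)
  finally show ?thesis using ratio_plus_one_nonzero by (metis nonzero_eq_divide_eq)
qed

lemma divide_ratio_bound: "cmod (w / (ratio \<beta> l + 1)) \<le> cmod w"
  using ratio_plus_one_ge[of \<beta> l] divide_left_mono[of 1 "cmod (ratio \<beta> l + 1)" "cmod w"]
    ratio_plus_one_nonzero[of \<beta> l]
  by (simp add: norm_divide)

text \<open>By \<open>ratio_minus_one\<close> the large factor \<open>l\<close> cancels in
  \<open>l * (ratio \<beta> l - 1)\<close>, so the root stays at bounded distance from the
  period.\<close>

lemma shifted_root_eq: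
  assumes "shift n z \<noteq> 0"
  shows "shift n z * ratio \<beta> (shift n z) = shifted_root \<beta> n z + of_real (2 * pi * real n) * \<i>"
proof -
  have "shift n z * (ratio \<beta> (shift n z) - 1) = \<beta> / (ratio \<beta> (shift n z) + 1)"
    unfolding ratio_minus_one using assms by simp
  then show ?thesis by (simp add: shifted_root_def shift_def algebra_simps)
qed

lemma exp_plus_period:
  "exp (x + of_real (2 * pi * real n) * \<i>) = exp x"
  "exp (- (x + of_real (2 * pi * real n) * \<i>)) = exp (- x)"
proof -
  have 1: "exp (of_real (2 * pi * real n) * \<i>) = 1"
    using exp_integer_2pi[of "of_nat n"] by (simp add: mult_ac)
  then show "exp (x + of_real (2 * pi * real n) * \<i>) = exp x"
    by (simp add: exp_add)
  then show "exp (- (x + of_real (2 * pi * real n) * \<i>)) = exp (- x)"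
    by (simp only: exp_minus)
qed

lemma sinh_cosh_plus_period:
  fixes x :: complex
  shows "sinh (x + of_real (2 * pi * real n) * \<i>) = sinh x"
    and "cosh (x + of_real (2 * pi * real n) * \<i>) = cosh x"
  unfolding sinh_field_def cosh_field_def exp_plus_period by simp_all

lemma shift_bounds:
  assumes "cmod z \<le> 1" and "n \<ge> 1"
  shows "Im (shift n z) \<ge> real n" and "cmod (shift n z) \<ge> real n" and "shift n z \<noteq> 0"
proof -
  have "\<bar>Im z\<bar> \<le> 1" using abs_Im_le_cmod[of z] assms by linarith
  \<comment> \<open>The crude bound pi \<ge> 2 suffices: the imaginary part is at least 4n - 1,
    hence at least n.\<close>
  moreover have "2 * real n \<le> pi * real n"
    using pi_ge_two by (intro mult_right_mono) auto
  moreover have "real n \<ge> 1" using assms(2) by simp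
  moreover have "Im (shift n z) = Im z + 2 * (pi * real n)" by (simp add: shift_def)
  ultimately show 1: "Im (shift n z) \<ge> real n" by linarith
  then show "cmod (shift n z) \<ge> real n"
    using abs_Im_le_cmod[of "shift n z"] by linarith
  show "shift n z \<noteq> 0" using 1 assms(2) by auto
qed

text \<open>Uniform in \<open>z\<close> because the modulus of \<open>shift n z\<close> is at least
  \<open>n\<close> throughout the unit disc.\<close>

lemma small_quotient:
  assumes "S \<subseteq> cball 0 1" and "e > 0"
  shows "\<forall>\<^sub>F n in sequentially. n \<ge> 1 \<and> (\<forall>z\<in>S. cmod (\<beta> / shift n z) < e)"
proof -
  have "(\<lambda>n. cmod \<beta> / real n) \<longlonglongrightarrow> 0"
    by (rule lim_const_over_n)
  then have "\<forall>\<^sub>F n in sequentially. cmod \<beta> / real n < e"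
    using assms(2) by (rule order_tendstoD)
  moreover have "\<forall>\<^sub>F n in sequentially. (n::nat) \<ge> 1"
    by (rule eventually_ge_at_top)
  ultimately show ?thesis
  proof eventually_elim
    case (elim n)
    have "cmod (\<beta> / shift n z) < e" if "z \<in> S" for z
    proof -
      have "cmod z \<le> 1" using that assms by auto
      from shift_bounds(2)[OF this elim(2)]
      have "cmod \<beta> / cmod (shift n z) \<le> cmod \<beta> / real n"
        using elim(2) by (intro divide_left_mono mult_pos_pos) auto
      then show ?thesis using elim(1) by (simp add: norm_divide)
    qed
    with elim show ?case by simp
  qed
qed

lemma ratio_uniform_limit:
  assumes "S \<subseteq> cball 0 1"
  shows "uniform_limit S (\<lambda>n z. ratio \<beta> (shift n z)) (\<lambda>_. 1) sequentially"
proof (rule uniform_limitI)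
  fix e :: real assume "e > 0"
  from small_quotient[OF assms this, of \<beta>]
  show "\<forall>\<^sub>F n in sequentially. \<forall>z\<in>S. dist (ratio \<beta> (shift n z)) 1 < e"
  proof eventually_elim
    case (elim n)
    then show ?case
      using divide_ratio_bound[of "\<beta> / shift n z" \<beta> "shift n z" for z]
      by (auto simp: dist_norm ratio_minus_one intro: le_less_trans)
  qed
qed

text \<open>Since \<open>ratio\<close> tends to 1, the quotient \<beta> / (\<open>ratio\<close> + 1)
  tends to \<beta> / 2.\<close>

lemma shifted_root_uniform_limit:
  assumes "S \<subseteq> cball 0 1"
  shows "uniform_limit S (shifted_root \<beta>) (\<lambda>z. z + \<beta> / 2) sequentially"
proof (rule uniform_limitI)
  fix e :: real assume "e > 0"
  \<comment> \<open>The summand 1 keeps the tolerance meaningful when \<beta> is 0.\<close>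
  then have "e / (cmod \<beta> + 1) > 0" by (simp add: add_nonneg_pos)
  from uniform_limitD[OF ratio_uniform_limit[OF assms] this, of \<beta>]
  show "\<forall>\<^sub>F n in sequentially. \<forall>z\<in>S. dist (shifted_root \<beta> n z) (z + \<beta> / 2) < e"
  proof eventually_elim
    case (elim n)
    show ?case
    proof
      fix z assume "z \<in> S"
      define s where "s = ratio \<beta> (shift n z)"
      have s: "s + 1 \<noteq> 0" "cmod (s - 1) < e / (cmod \<beta> + 1)"
        using elim \<open>z \<in> S\<close> ratio_plus_one_nonzero by (auto simp: s_def dist_norm)
      have "shifted_root \<beta> n z - (z + \<beta> / 2) = (- \<beta> * (s - 1) / 2) / (s + 1)"
        unfolding shifted_root_def s_def[symmetric] using s(1) by (simp add: field_simps)
      then have "dist (shifted_root \<beta> n z) (z + \<beta> / 2) \<le> cmod (- \<beta> * (s - 1) / 2)"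
        unfolding dist_norm using divide_ratio_bound[of "- \<beta> * (s - 1) / 2" \<beta> "shift n z"]
        by (simp add: s_def)
      also have "\<dots> = cmod \<beta> * cmod (s - 1) / 2"
        by (simp only: norm_mult norm_divide norm_minus_cancel norm_numeral)
      also have "\<dots> \<le> (cmod \<beta> + 1) * cmod (s - 1)"
        by (simp add: distrib_right)
      also have "\<dots> < e"
        using s(2) by (simp add: pos_less_divide_eq add_nonneg_pos mult.commute)
      finally show "dist (shifted_root \<beta> n z) (z + \<beta> / 2) < e" .
    qed
  qed
qed

text \<open>All shifted roots lie in one compact ball, where \<open>f\<close> is uniformly
  continuous and therefore preserves uniform convergence.\<close>

lemma shifted_root_compose_uniform_limit:
  fixes f :: "complex \<Rightarrow> complex"
  assumes "S \<subseteq> cball 0 1" and "continuous_on UNIV f"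
  shows "uniform_limit S (\<lambda>n z. f (shifted_root \<beta> n z)) (\<lambda>z. f (z + \<beta> / 2)) sequentially"
proof (rule uniform_limit_compose_uniformly_continuous_on[OF shifted_root_uniform_limit[OF assms(1)]])
  let ?B = "cball (0::complex) (1 + cmod \<beta>)"
  show "uniformly_continuous_on ?B f"
    by (rule compact_uniformly_continuous) (auto intro: continuous_on_subset[OF assms(2)])
  have "cmod (shifted_root \<beta> n z) \<le> 1 + cmod \<beta>" if "z \<in> S" for n z
    unfolding shifted_root_def
    using that assms(1) divide_ratio_bound[of \<beta> \<beta> "shift n z"]
    by (intro norm_triangle_le add_mono) auto
  then show "\<forall>\<^sub>F n in sequentially. \<forall>z\<in>S. shifted_root \<beta> n z \<in> ?B"
    by (intro always_eventually) auto
qed auto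

section \<open>Uniform limit and zeros of the characteristic function\<close>

lemma uniform_limit_mult_continuous:
  fixes l m :: "complex \<Rightarrow> complex"
  assumes "uniform_limit S f l F" and "uniform_limit S g m F"
    and "compact S" and "continuous_on S l" and "continuous_on S m"
  shows "uniform_limit S (\<lambda>n z. f n z * g n z) (\<lambda>z. l z * m z) F"
  using assms by (intro uniform_lim_mult compact_imp_bounded compact_continuous_image)

text \<open>The characteristic function divided by \<open>l\<close>, evaluated at
  \<open>l = shift n z\<close>, with the periods removed from the arguments. \<open>G\<close> stands
  for 2\<gamma>\<kappa>(\<alpha>)K and \<beta> for i b.\<close>

definition charF :: "(complex \<Rightarrow> complex) \<Rightarrow> complex \<Rightarrow> nat \<Rightarrow> complex \<Rightarrow> complex" where
  "charF G \<beta> n z =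
     ratio (- \<beta>) (shift n z) * (cosh (shifted_root (- \<beta>) n z) * sinh (shifted_root \<beta> n z))
     + ratio \<beta> (shift n z) * (cosh (shifted_root \<beta> n z) * sinh (shifted_root (- \<beta>) n z))
     + G (shift n z) * (sinh (shifted_root (- \<beta>) n z) * sinh (shifted_root \<beta> n z))"

text \<open>Both ratios tend to 1 and the \<open>G\<close> term disappears. The addition formula for
  \<open>sinh\<close> at \<open>z + \<beta> / 2\<close> and \<open>z - \<beta> / 2\<close> combines
  the rest, and \<beta> cancels in the sum of the arguments.\<close>

lemma charF_uniform_limit:
  assumes "S \<subseteq> cball 0 1" and "compact S"
    and G: "uniform_limit S (\<lambda>n z. G (shift n z)) (\<lambda>_. 0) sequentially"
  shows "uniform_limit S (charF G \<beta>) (\<lambda>z. sinh (2 * z)) sequentially"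
proof -
  have [continuous_intros]: "continuous_on A (\<lambda>z. cosh (z + c))" "continuous_on A (\<lambda>z. sinh (z + c))"
    for A and c :: complex
    by (intro continuous_intros)+
  have C: "uniform_limit S (\<lambda>n z. cosh (shifted_root b n z)) (\<lambda>z. cosh (z + b / 2)) sequentially" for b
    by (rule shifted_root_compose_uniform_limit[OF assms(1)]) (intro continuous_intros)
  have D: "uniform_limit S (\<lambda>n z. sinh (shifted_root b n z)) (\<lambda>z. sinh (z + b / 2)) sequentially" for b
    by (rule shifted_root_compose_uniform_limit[OF assms(1)]) (intro continuous_intros)
  have "uniform_limit S (charF G \<beta>)
    (\<lambda>z. 1 * (cosh (z + (- \<beta>) / 2) * sinh (z + \<beta> / 2))
       + 1 * (cosh (z + \<beta> / 2) * sinh (z + (- \<beta>) / 2))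
       + 0 * (sinh (z + (- \<beta>) / 2) * sinh (z + \<beta> / 2))) sequentially"
    unfolding charF_def
    by (intro uniform_limit_add uniform_limit_mult_continuous ratio_uniform_limit assms C D
        continuous_intros)
  moreover have "1 * (cosh (z + (- \<beta>) / 2) * sinh (z + \<beta> / 2))
       + 1 * (cosh (z + \<beta> / 2) * sinh (z + (- \<beta>) / 2))
       + 0 * (sinh (z + (- \<beta>) / 2) * sinh (z + \<beta> / 2)) = sinh (2 * z)" for z
    using sinh_add[of "z + \<beta> / 2" "z + (- \<beta>) / 2"] by (simp add: algebra_simps)
  ultimately show ?thesis by (simp only:)
qed

lemma charF_continuous:
  assumes "S \<subseteq> cball 0 1" and "n \<ge> 1" and small: "\<And>z. z \<in> S \<Longrightarrow> cmod (\<beta> / shift n z) < 1"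
    and G: "continuous_on S (\<lambda>z. G (shift n z))"
  shows "continuous_on S (charF G \<beta> n)"
proof -
  have nz: "shift n z \<noteq> 0" if "z \<in> S" for z
    using shift_bounds(3)[of z n] that assms(1,2) by auto
  have [continuous_intros]: "continuous_on S (\<lambda>z. ratio b (shift n z))" if "b = \<beta> \<or> b = - \<beta>" for b
  proof -
    \<comment> \<open>The radicand has positive real part, so it avoids the branch cut of
      \<open>csqrt\<close>.\<close>
    have "1 + b / shift n z \<notin> \<real>\<^sub>\<le>\<^sub>0" if "z \<in> S" for z
      using Re_one_plus_pos[of "b / shift n z"] small[OF that] \<open>b = \<beta> \<or> b = - \<beta>\<close>
      by (auto simp: complex_nonpos_Reals_iff norm_divide)
    then show ?thesis
      unfolding ratio_def using nz
      by (intro continuous_on_compose2[OF continuous_on_csqrt]) 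
        (auto simp: shift_def intro!: continuous_intros)
  qed
  show ?thesis
    unfolding charF_def shifted_root_def
    by (intro continuous_intros G) (auto simp: ratio_plus_one_nonzero)
qed

text \<open>The derivative of \<open>z - sinh (2 * z) / 2\<close> at 0 is 1 - 1 = 0, so the function
  is o(|z|).\<close>

lemma sinh_near_zero: "\<exists>r>0. \<forall>z::complex. cmod z \<le> r \<longrightarrow> cmod (z - sinh (2 * z) / 2) \<le> cmod z / 2"
proof -
  have "((\<lambda>z::complex. z - sinh (2 * z) / 2) has_field_derivative (1 - cosh (2 * 0) * 2 / 2)) (at 0)"
    by (auto intro!: derivative_eq_intros)
  then have "((\<lambda>z::complex. z - sinh (2 * z) / 2) has_derivative (\<lambda>_. 0)) (at 0)"
    by (simp add: has_field_derivative_def lambda_zero)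
  then obtain d where "d > 0" and d: "\<And>z::complex. cmod z < d \<Longrightarrow> cmod (z - sinh (2 * z) / 2) \<le> 1/2 * cmod z"
    unfolding has_derivative_at_alt by (force dest: spec[of _ "1/2"])
  then show ?thesis by (intro exI[of _ "d / 2"]) auto
qed

text \<open>Zeros of \<open>charF\<close> are the fixed points of
  \<open>z - charF G \<beta> n z / 2\<close>, a perturbed Newton map for the limit at 0 that sends a
  small disc into itself once \<open>n\<close> is large.\<close>

lemma charF_zero:
  assumes "\<delta> > 0"
    and cont: "continuous_on {l. Re l \<ge> - \<delta>} G"
    and decay: "\<And>e. e > 0 \<Longrightarrow> \<exists>R. \<forall>l. Re l \<ge> - \<delta> \<and> Im l \<ge> R \<longrightarrow> cmod (G l) < e"
  shows "\<exists>n z. n \<ge> 1 \<and> real n > R \<and> cmod z \<le> 1 \<and> cmod z \<le> \<delta> \<and> charF G \<beta> n z = 0"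
proof -
  obtain r0 where "r0 > 0" and r0: "\<And>z::complex. cmod z \<le> r0 \<Longrightarrow> cmod (z - sinh (2 * z) / 2) \<le> cmod z / 2"
    using sinh_near_zero by blast
  \<comment> \<open>\<open>r0\<close> serves the estimate near 0, the bound 1 serves
    \<open>shift_bounds\<close>, and \<delta> keeps the real part of \<open>shift n z\<close> at
    least -\<delta>.\<close>
  define r where "r = min r0 (min 1 \<delta>)"
  define S where "S = cball (0::complex) r"
  have r: "r > 0" "r \<le> 1" "r \<le> \<delta>" "r \<le> r0"
    using \<open>r0 > 0\<close> assms(1) by (auto simp: r_def)
  have S1: "S \<subseteq> cball 0 1" and "compact S" using r by (auto simp: S_def)
  have Re: "Re (shift n z) \<ge> - \<delta>" if "z \<in> S" for n z
    using abs_Re_le_cmod[of z] that r by (auto simp: S_def shift_def)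
  have "uniform_limit S (\<lambda>n z. G (shift n z)) (\<lambda>_. 0) sequentially"
  proof (rule uniform_limitI)
    fix e :: real assume "e > 0"
    then obtain R where R: "\<And>l. Re l \<ge> - \<delta> \<Longrightarrow> Im l \<ge> R \<Longrightarrow> cmod (G l) < e"
      using decay by blast
    have "\<forall>\<^sub>F n in sequentially. real n \<ge> R"
      using filterlim_real_sequentially by (simp add: filterlim_at_top)
    moreover have "\<forall>\<^sub>F n in sequentially. (n::nat) \<ge> 1"
      by (rule eventually_ge_at_top)
    ultimately show "\<forall>\<^sub>F n in sequentially. \<forall>z\<in>S. dist (G (shift n z)) 0 < e"
    proof eventually_elim
      case (elim n)
      show ?case
      proof
        fix z assume "z \<in> S"
        then have "Im (shift n z) \<ge> R"
          using shift_bounds(1)[of z n] elim S1 by force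
        then show "dist (G (shift n z)) 0 < e"
          using R Re[OF \<open>z \<in> S\<close>] by simp
      qed
    qed
  qed
  from uniform_limitD[OF charF_uniform_limit[OF S1 \<open>compact S\<close> this] r(1), of \<beta>]
  have close: "\<forall>\<^sub>F n in sequentially. \<forall>z\<in>S. dist (charF G \<beta> n z) (sinh (2 * z)) < r" .
  have "\<forall>\<^sub>F n in sequentially. real n > R"
    using filterlim_real_sequentially by (simp add: filterlim_at_top_dense)
  from eventually_conj[OF this eventually_conj[OF close small_quotient[OF S1, of 1 \<beta>]]]
  obtain n where n: "real n > R" "n \<ge> 1"
    and close: "\<And>z. z \<in> S \<Longrightarrow> dist (charF G \<beta> n z) (sinh (2 * z)) < r"
    and small: "\<And>z. z \<in> S \<Longrightarrow> cmod (\<beta> / shift n z) < 1"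
    unfolding eventually_sequentially by auto
  have "continuous_on S (\<lambda>z. G (shift n z))"
    using Re by (intro continuous_on_compose2[OF cont]) (auto simp: shift_def intro!: continuous_intros)
  then have contF: "continuous_on S (charF G \<beta> n)"
    using small n(2) by (intro charF_continuous[OF S1])
  obtain z where z: "z \<in> S" "z - charF G \<beta> n z / 2 = z"
  proof (rule brouwer)
    show "compact S" "convex S" "S \<noteq> {}" using r by (auto simp: S_def)
    show "continuous_on S (\<lambda>z. z - charF G \<beta> n z / 2)"
      by (intro continuous_intros contF) auto
    show "(\<lambda>z. z - charF G \<beta> n z / 2) \<in> S \<rightarrow> S"
    proof
      fix z assume "z \<in> S"
      then have "cmod z \<le> r" by (simp add: S_def)
      \<comment> \<open>The first bracket is at most |z|/2 by the choice of \<open>r0\<close>, the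
        second at most r/2 by uniform closeness to the limit; together they stay within
        \<open>r\<close>.\<close>
      have "z - charF G \<beta> n z / 2 = (z - sinh (2 * z) / 2) - (charF G \<beta> n z - sinh (2 * z)) / 2"
        by (simp add: field_simps)
      also have "cmod \<dots> \<le> cmod (z - sinh (2 * z) / 2) + cmod ((charF G \<beta> n z - sinh (2 * z)) / 2)"
        by (rule norm_triangle_ineq4)
      also have "\<dots> \<le> r / 2 + r / 2"
        using close[OF \<open>z \<in> S\<close>] r0[of z] \<open>cmod z \<le> r\<close> r(4)
        by (intro add_mono) (auto simp: dist_norm norm_divide)
      finally show "z - charF G \<beta> n z / 2 \<in> S" by (simp add: S_def)
    qed
  qed
  then show ?thesis using n r by (intro exI[of _ n] exI[of _ z]) (auto simp: S_def)
qed

text \<open>Undoes the normalisation of \<open>charF\<close>: multiplication by \<open>l\<close>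
  restores the factors \<open>r1\<close> and \<open>r2\<close>, and periodicity restores the
  arguments of \<open>sinh\<close> and \<open>cosh\<close>.\<close>

lemma characteristic_root:
  assumes "\<delta> > 0"
    and cont: "continuous_on {l. Re l \<ge> - \<delta>} G"
    and decay: "\<And>e. e > 0 \<Longrightarrow> \<exists>R. \<forall>l. Re l \<ge> - \<delta> \<and> Im l \<ge> R \<longrightarrow> cmod (G l) < e"
  shows "\<exists>l r1 r2. Re l \<ge> - \<delta> \<and> Im l > R \<and> l \<noteq> 0 \<and> r1\<^sup>2 = l\<^sup>2 - \<beta> * l \<and> r2\<^sup>2 = l\<^sup>2 + \<beta> * l
     \<and> r1 * cosh r1 * sinh r2 + r2 * cosh r2 * sinh r1 + l * G l * sinh r1 * sinh r2 = 0"
proof -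
  obtain n z where n: "n \<ge> 1" "real n > R" and z: "cmod z \<le> 1" "cmod z \<le> \<delta>" "charF G \<beta> n z = 0"
    using charF_zero[OF assms] by blast
  define l where "l = shift n z"
  define r where "r b = l * ratio b l" for b
  note b = shift_bounds[OF z(1) n(1), folded l_def]
  have sq: "(r b)\<^sup>2 = l\<^sup>2 + b * l" for b
  proof -
    have "(r b)\<^sup>2 = l\<^sup>2 * (1 + b / l)"
      by (simp add: r_def ratio_def power_mult_distrib)
    then show ?thesis using b(3) by (simp add: power2_eq_square distrib_left)
  qed
  have sc: "sinh (r b) = sinh (shifted_root b n z)" "cosh (r b) = cosh (shifted_root b n z)" for b
    unfolding r_def l_def shifted_root_eq[OF b(3)[unfolded l_def]] sinh_cosh_plus_period by simp_all
  have "r (-\<beta>) * cosh (r (-\<beta>)) * sinh (r \<beta>) + r \<beta> * cosh (r \<beta>) * sinh (r (-\<beta>))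
      + l * G l * sinh (r (-\<beta>)) * sinh (r \<beta>) = l * charF G \<beta> n z"
    unfolding sc charF_def by (simp add: r_def l_def algebra_simps)
  moreover have "Re l \<ge> - \<delta>"
    using abs_Re_le_cmod[of z] z(2) by (auto simp: l_def shift_def)
  ultimately show ?thesis
    using b n(2) z(3) sq[of "-\<beta>"] sq[of \<beta>]
    by (intro exI[of _ l] exI[of _ "r (-\<beta>)"] exI[of _ "r \<beta>"]) auto
qed

subsection \<open>Eigenvectors and exponential solutions\<close>

text \<open>Vanishing at 0 builds in the left boundary condition; differentiation alternates between
  \<open>sinhs\<close> and \<open>coshs\<close> and only changes the amplitudes.\<close>

definition sinhs :: "complex \<Rightarrow> complex \<Rightarrow> complex \<Rightarrow> complex \<Rightarrow> real \<Rightarrow> complex" where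
  "sinhs r1 r2 A B x = A * sinh (r1 * of_real x) + B * sinh (r2 * of_real x)"

definition coshs :: "complex \<Rightarrow> complex \<Rightarrow> complex \<Rightarrow> complex \<Rightarrow> real \<Rightarrow> complex" where
  "coshs r1 r2 A B x = A * cosh (r1 * of_real x) + B * cosh (r2 * of_real x)"

lemma sinhs_derivative:
  "(sinhs r1 r2 A B has_vector_derivative coshs r1 r2 (A * r1) (B * r2) x) (at x)"
proof -
  have "((\<lambda>z. A * sinh (r1 * z) + B * sinh (r2 * z)) has_field_derivative
      (A * r1 * cosh (r1 * of_real x) + B * r2 * cosh (r2 * of_real x))) (at (of_real x))"
    by (auto intro!: derivative_eq_intros simp: mult_ac)
  from has_vector_derivative_real_field[OF this] show ?thesis
    by (simp add: sinhs_def[abs_def] coshs_def)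
qed

lemma coshs_derivative:
  "(coshs r1 r2 A B has_vector_derivative sinhs r1 r2 (A * r1) (B * r2) x) (at x)"
proof -
  have "((\<lambda>z. A * cosh (r1 * z) + B * cosh (r2 * z)) has_field_derivative
      (A * r1 * sinh (r1 * of_real x) + B * r2 * sinh (r2 * of_real x))) (at (of_real x))"
    by (auto intro!: derivative_eq_intros simp: mult_ac)
  from has_vector_derivative_real_field[OF this] show ?thesis
    by (simp add: sinhs_def coshs_def[abs_def])
qed

lemma continuous_on_sinhs: "continuous_on S (sinhs r1 r2 A B)"
  using sinhs_derivative has_vector_derivative_continuous
  by (blast intro: continuous_at_imp_continuous_on)

lemma continuous_on_coshs: "continuous_on S (coshs r1 r2 A B)"
  using coshs_derivative has_vector_derivative_continuous
  by (blast intro: continuous_at_imp_continuous_on)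

lemma wderiv_sinhs: "wderiv (sinhs r1 r2 A B) (coshs r1 r2 (A * r1) (B * r2))"
  by (intro wderiv_if_has_derivative sinhs_derivative continuous_on_coshs)

lemma wderiv_coshs: "wderiv (coshs r1 r2 A B) (sinhs r1 r2 (A * r1) (B * r2))"
  by (intro wderiv_if_has_derivative coshs_derivative continuous_on_sinhs)

lemma sinhs_cmult: "sinhs r1 r2 (c * A) (c * B) x = c * sinhs r1 r2 A B x"
  by (simp add: sinhs_def algebra_simps)

lemma H1_sinhs: "H1 (sinhs r1 r2 A B)"
  unfolding H1_def using L2_continuous[OF continuous_on_sinhs] wderiv_sinhs by blast

lemma H1_coshs: "H1 (coshs r1 r2 A B)"
  unfolding H1_def using L2_continuous[OF continuous_on_coshs] wderiv_coshs by blast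

lemma H2_sinhs: "H2 (sinhs r1 r2 A B)"
  unfolding H2_def using L2_continuous[OF continuous_on_sinhs] wderiv_sinhs H1_coshs by blast

lemma H1_cmult_sinhs: "H1 (\<lambda>x. l * sinhs r1 r2 A B x)"
proof -
  have "(\<lambda>x. l * sinhs r1 r2 A B x) = sinhs r1 r2 (l * A) (l * B)"
    by (simp add: fun_eq_iff sinhs_cmult)
  then show ?thesis by (simp only: H1_sinhs)
qed

section \<open>The diffusive component of the eigenvector\<close>

lemma L2_UNIV_if_bounded:
  fixes f :: "real \<Rightarrow> complex"
  assumes "0 < \<alpha>" and "\<alpha> < 1" and "c > 0" and [measurable]: "f \<in> borel_measurable borel"
    and bound: "\<And>\<xi>. (cmod (f \<xi>))\<^sup>2 \<le> K * ((mu \<alpha> \<xi>)\<^sup>2 / (\<xi>\<^sup>2 + c))"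
  shows "L2 UNIV f"
proof -
  have K: "integrable lborel (\<lambda>\<xi>. K * ((mu \<alpha> \<xi>)\<^sup>2 / (\<xi>\<^sup>2 + c)))"
    by (intro integrable_mult_right integrable_mu_square assms(1-3))
  have "norm ((cmod (f \<xi>))\<^sup>2) \<le> norm (K * ((mu \<alpha> \<xi>)\<^sup>2 / (\<xi>\<^sup>2 + c)))" for \<xi>
    using order_trans[OF bound abs_ge_self, of \<xi>] by simp
  then have "integrable lborel (\<lambda>\<xi>. (cmod (f \<xi>))\<^sup>2)"
    by (intro Bochner_Integration.integrable_bound[OF K] AE_I2) simp_all
  then have "integrable lebesgue (\<lambda>\<xi>. (cmod (f \<xi>))\<^sup>2)"
    by (subst integrable_completion) auto
  moreover have "f \<in> borel_measurable lebesgue"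
    by (rule measurable_completion) simp
  ultimately show ?thesis
    by (simp add: L2_def lebesgue_on_UNIV_eq)
qed

text \<open>The resolvent of multiplication by -(\<xi>^2 + \<eta>) applied to \<open>c\<close> times
  \<open>mu\<close>; \<open>c\<close> will be the boundary value v(1).\<close>

definition diffmode :: "real \<Rightarrow> real \<Rightarrow> complex \<Rightarrow> complex \<Rightarrow> real \<Rightarrow> complex" where
  "diffmode \<alpha> \<eta> l c \<xi> = c * of_real (mu \<alpha> \<xi>) / (complex_of_real (\<xi>\<^sup>2 + \<eta>) + l)"

lemma diffmode_measurable [measurable]: "diffmode \<alpha> \<eta> l c \<in> borel_measurable borel"
  unfolding diffmode_def[abs_def] by measurable

text \<open>With q = \<xi>^2 + \<eta>/2 the squared denominator is at least q^2. One factor 1/q is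
  kept for the integrable kernel; the other is bounded by 2/\<eta>, or absorbs \<xi>^2 \<le>
  q.\<close>

lemma diffmode_norm_bounds:
  assumes "\<eta> > 0" and "Re l \<ge> - \<eta> / 2"
  shows "(cmod (diffmode \<alpha> \<eta> l c \<xi>))\<^sup>2 \<le> (cmod c)\<^sup>2 * (2 / \<eta>) * ((mu \<alpha> \<xi>)\<^sup>2 / (\<xi>\<^sup>2 + \<eta> / 2))"
    and "(cmod (complex_of_real \<bar>\<xi>\<bar> * diffmode \<alpha> \<eta> l c \<xi>))\<^sup>2
      \<le> (cmod c)\<^sup>2 * ((mu \<alpha> \<xi>)\<^sup>2 / (\<xi>\<^sup>2 + \<eta> / 2))"
proof -
  define d where "d = cmod (complex_of_real (\<xi>\<^sup>2 + \<eta>) + l)"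
  define q where "q = \<xi>\<^sup>2 + \<eta> / 2"
  have q: "0 < q" "\<eta> / 2 \<le> q" "\<xi>\<^sup>2 \<le> q"
    using assms by (auto simp: q_def intro: add_nonneg_pos)
  have d: "q \<le> d"
    using denom_ge_Re[OF assms(2)] by (simp add: d_def q_def)
  have "d\<^sup>2 \<ge> q * q"
    unfolding power2_eq_square using q d by (intro mult_mono) auto
  have norm: "(cmod (diffmode \<alpha> \<eta> l c \<xi>))\<^sup>2 = (cmod c)\<^sup>2 * (mu \<alpha> \<xi>)\<^sup>2 * (1 / d\<^sup>2)"
    by (simp add: diffmode_def d_def norm_mult norm_divide power_mult_distrib power_divide)
  have 1: "1 / d\<^sup>2 \<le> 1 / (q * q)"
    using q(1) less_le_trans[OF q(1) d] \<open>d\<^sup>2 \<ge> q * q\<close>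
    by (intro divide_left_mono mult_pos_pos zero_less_power) simp_all
  have 2: "1 / (q * q) \<le> 2 / \<eta> * (1 / q)"
    using q assms(1) by (simp add: field_simps)
  have 3: "\<xi>\<^sup>2 * (1 / (q * q)) \<le> 1 / q"
    using q by (simp add: field_simps)
  show "(cmod (diffmode \<alpha> \<eta> l c \<xi>))\<^sup>2 \<le> (cmod c)\<^sup>2 * (2 / \<eta>) * ((mu \<alpha> \<xi>)\<^sup>2 / (\<xi>\<^sup>2 + \<eta> / 2))"
    using mult_left_mono[OF order_trans[OF 1 2], of "(cmod c)\<^sup>2 * (mu \<alpha> \<xi>)\<^sup>2"]
    unfolding norm by (simp add: q_def mult_ac)
  have "\<xi>\<^sup>2 * (1 / d\<^sup>2) \<le> 1 / q"
    using mult_left_mono[OF 1, of "\<xi>\<^sup>2"] 3 by simp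
  from mult_left_mono[OF this, of "(cmod c)\<^sup>2 * (mu \<alpha> \<xi>)\<^sup>2"]
  have "\<xi>\<^sup>2 * ((cmod c)\<^sup>2 * (mu \<alpha> \<xi>)\<^sup>2 * (1 / d\<^sup>2)) \<le> (cmod c)\<^sup>2 * ((mu \<alpha> \<xi>)\<^sup>2 / q)"
    by (simp add: mult_ac)
  then show "(cmod (complex_of_real \<bar>\<xi>\<bar> * diffmode \<alpha> \<eta> l c \<xi>))\<^sup>2
      \<le> (cmod c)\<^sup>2 * ((mu \<alpha> \<xi>)\<^sup>2 / (\<xi>\<^sup>2 + \<eta> / 2))"
    unfolding norm_mult power_mult_distrib norm by (simp add: q_def)
qed

lemma diffmode_equation:
  assumes "\<eta> > 0" and "Re l \<ge> - \<eta> / 2"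
  shows "- complex_of_real (\<xi>\<^sup>2 + \<eta>) * diffmode \<alpha> \<eta> l c \<xi> + c * complex_of_real (mu \<alpha> \<xi>)
    = l * diffmode \<alpha> \<eta> l c \<xi>"
proof -
  have "(complex_of_real (\<xi>\<^sup>2 + \<eta>) + l) * diffmode \<alpha> \<eta> l c \<xi> = c * complex_of_real (mu \<alpha> \<xi>)"
    using denom_nonzero[OF assms, of \<xi>] by (simp add: diffmode_def)
  then show ?thesis by (simp only: distrib_right mult_minus_left) (metis add.commute add_diff_cancel_left' uminus_add_conv_diff)
qed

lemma diffmode_cmult: "diffmode \<alpha> \<eta> l (k * c) \<xi> = k * diffmode \<alpha> \<eta> l c \<xi>"
  by (simp add: diffmode_def)

lemma mu_diffmode:
  "complex_of_real (mu \<alpha> \<xi>) * diffmode \<alpha> \<eta> l c \<xi> =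
     c * (complex_of_real ((mu \<alpha> \<xi>)\<^sup>2) / (complex_of_real (\<xi>\<^sup>2 + \<eta>) + l))"
  by (simp add: diffmode_def power2_eq_square mult_ac)

text \<open>With \<open>u \<plusminus> \<i> y\<close> as unknowns the two wave equations decouple into
  \<open>p'' = (l\<^sup>2 \<mp> \<i> b l) p\<close>; here \<open>u + \<i> y = 2 A sinh (r1 x)\<close> and \<open>u - \<i> y = 2 B sinh (r2 x)\<close>.\<close>

definition mode :: "real \<Rightarrow> real \<Rightarrow> complex \<Rightarrow> complex \<Rightarrow> complex \<Rightarrow> complex \<Rightarrow> complex \<Rightarrow> st" where
  "mode \<alpha> \<eta> l r1 r2 A B =
     (sinhs r1 r2 A B, \<lambda>x. l * sinhs r1 r2 A B x,
      sinhs r1 r2 (- \<i> * A) (\<i> * B), \<lambda>x. l * sinhs r1 r2 (- \<i> * A) (\<i> * B) x,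
      diffmode \<alpha> \<eta> l (l * sinhs r1 r2 A B 1))"

lemma mode_cmult: "st_scale c (mode \<alpha> \<eta> l r1 r2 A B) = mode \<alpha> \<eta> l r1 r2 (c * A) (c * B)"
  by (simp add: mode_def fun_eq_iff sinhs_def diffmode_def algebra_simps)

lemma mode_diff:
  "st_sub (mode \<alpha> \<eta> l r1 r2 A B) (mode \<alpha> \<eta> l r1 r2 A' B') = mode \<alpha> \<eta> l r1 r2 (A - A') (B - B')"
  by (simp add: mode_def fun_eq_iff sinhs_def diffmode_def algebra_simps diff_divide_distrib)

lemma normH_mode_cmult:
  "normH \<alpha> \<gamma> (mode \<alpha>' \<eta> l r1 r2 (c * A) (c * B)) = cmod c * normH \<alpha> \<gamma> (mode \<alpha>' \<eta> l r1 r2 A B)"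
  unfolding mode_cmult[symmetric] unfolding mode_def by (rule normH_scale[OF wderiv_sinhs wderiv_sinhs])

lemma normH_mode_pos:
  assumes "\<gamma> > 0" and "0 < \<alpha>" and "\<alpha> < 1" and "r1 \<noteq> 0" and "r2 \<noteq> 0" and "A \<noteq> 0 \<or> B \<noteq> 0"
  shows "normH \<alpha> \<gamma> (mode \<alpha> \<eta> l r1 r2 A B) > 0"
  unfolding mode_def
proof (rule normH_pos[OF wderiv_sinhs wderiv_sinhs assms(1-3) continuous_on_coshs continuous_on_coshs])
  \<comment> \<open>The hypotheses say u'(0) = 0 and y'(0) = 0; they give the sum and the difference
    of \<open>A * r1\<close> and \<open>B * r2\<close>.\<close>
  have "A * r1 = 0 \<and> B * r2 = 0" if "A * r1 + B * r2 = 0" "- (\<i> * A * r1) + \<i> * B * r2 = 0"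
  proof -
    have "\<i> * (B * r2 - A * r1) = 0" using that(2) by (simp add: algebra_simps)
    then have "B * r2 = A * r1" by simp
    with that(1) show ?thesis by simp
  qed
  with assms(4-6)
  show "coshs r1 r2 (A * r1) (B * r2) 0 \<noteq> 0 \<or> coshs r1 r2 (- \<i> * A * r1) (\<i> * B * r2) 0 \<noteq> 0"
    by (auto simp: coshs_def)
qed

text \<open>This is the eigenvalue relation AU = lU, since scaling both amplitudes by
  \<open>l\<close> scales the mode. The prescribed squares of \<open>r1\<close> and
  \<open>r2\<close> encode l^2 u = u'' - b l y and l^2 y = y'' + b l u.\<close>

lemma Ahas_mode:
  assumes "\<eta> > 0" and "Re l \<ge> - \<eta> / 2"
    and r: "r1\<^sup>2 = l\<^sup>2 - \<i> * of_real b * l" "r2\<^sup>2 = l\<^sup>2 + \<i> * of_real b * l"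
  shows "Ahas \<alpha> \<eta> b (mode \<alpha> \<eta> l r1 r2 A B) (mode \<alpha> \<eta> l r1 r2 (l * A) (l * B))"
proof -
  have sq: "sinhs r1 r2 (C * r1 * r1) (D * r2 * r2) x
      = C * r1\<^sup>2 * sinh (r1 * of_real x) + D * r2\<^sup>2 * sinh (r2 * of_real x)" for C D x
    by (simp add: sinhs_def power2_eq_square mult_ac)
  have 1: "l * (l * sinhs r1 r2 A B x) = sinhs r1 r2 (A * r1 * r1) (B * r2 * r2) x
      - of_real b * (l * sinhs r1 r2 (- \<i> * A) (\<i> * B) x)" for x
    unfolding sq unfolding r unfolding sinhs_def by (simp add: algebra_simps power2_eq_square)
  have 2: "l * (l * sinhs r1 r2 (- \<i> * A) (\<i> * B) x) = sinhs r1 r2 (- \<i> * A * r1 * r1) (\<i> * B * r2 * r2) x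
      + of_real b * (l * sinhs r1 r2 A B x)" for x
    unfolding sq unfolding r unfolding sinhs_def by (simp add: algebra_simps power2_eq_square)
  show ?thesis
    unfolding mode_cmult[symmetric] unfolding mode_def Ahas.simps st_scale.simps
  proof (intro exI conjI)
    show "(\<lambda>x. l * sinhs r1 r2 A B x, \<lambda>x. l * (l * sinhs r1 r2 A B x),
        \<lambda>x. l * sinhs r1 r2 (- \<i> * A) (\<i> * B) x, \<lambda>x. l * (l * sinhs r1 r2 (- \<i> * A) (\<i> * B) x),
        \<lambda>x. l * diffmode \<alpha> \<eta> l (l * sinhs r1 r2 A B 1) x) =
      (\<lambda>x. l * sinhs r1 r2 A B x,
        \<lambda>x. sinhs r1 r2 (A * r1 * r1) (B * r2 * r2) x - of_real b * (l * sinhs r1 r2 (- \<i> * A) (\<i> * B) x),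
        \<lambda>x. l * sinhs r1 r2 (- \<i> * A) (\<i> * B) x,
        \<lambda>x. sinhs r1 r2 (- \<i> * A * r1 * r1) (\<i> * B * r2 * r2) x + of_real b * (l * sinhs r1 r2 A B x),
        \<lambda>\<xi>. - complex_of_real (\<xi>\<^sup>2 + \<eta>) * diffmode \<alpha> \<eta> l (l * sinhs r1 r2 A B 1) \<xi>
          + l * sinhs r1 r2 A B 1 * complex_of_real (mu \<alpha> \<xi>))"
      unfolding diffmode_equation[OF assms(1,2)] 1[symmetric] 2[symmetric] ..
  qed (rule wderiv_sinhs wderiv_coshs)+
qed

text \<open>\<open>E1\<close> is the condition y(1) = 0. \<open>E2\<close> is the boundary condition
  on u_x(1), because integrating \<open>mu\<close> against the diffusive component gives v(1) K(l)
  with v(1) = l u(1).\<close>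

lemma inDA_mode:
  assumes "0 < \<alpha>" and "\<alpha> < 1" and "\<eta> > 0" and "Re l \<ge> - \<eta> / 2"
    and E1: "A * sinh r1 = B * sinh r2"
    and E2: "A * r1 * cosh r1 + B * r2 * cosh r2
      + of_real (\<gamma> * kappa \<alpha>) * (l * (A * sinh r1 + B * sinh r2) * diffK \<alpha> \<eta> l) = 0"
  shows "inDA \<alpha> \<eta> \<gamma> (mode \<alpha> \<eta> l r1 r2 A B)"
proof -
  have w: "L2 UNIV (diffmode \<alpha> \<eta> l c)" for c
    by (rule L2_UNIV_if_bounded[OF assms(1,2) _ _ diffmode_norm_bounds(1)[OF assms(3,4)]])
      (use assms(3) in \<open>simp, measurable\<close>)
  have xw: "L2 UNIV (\<lambda>\<xi>. complex_of_real \<bar>\<xi>\<bar> * diffmode \<alpha> \<eta> l c \<xi>)" for c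
    by (rule L2_UNIV_if_bounded[OF assms(1,2) _ _ diffmode_norm_bounds(2)[OF assms(3,4)]])
      (use assms(3) in \<open>simp, measurable\<close>)
  \<comment> \<open>By \<open>diffmode_equation\<close> this is the last component of AU, so it must
    lie in L2 as well.\<close>
  have lw: "L2 UNIV (\<lambda>\<xi>. l * diffmode \<alpha> \<eta> l c \<xi>)" for c
  proof -
    have "(\<lambda>\<xi>. l * diffmode \<alpha> \<eta> l c \<xi>) = diffmode \<alpha> \<eta> l (l * c)"
      by (simp add: fun_eq_iff diffmode_cmult)
    then show ?thesis by (simp only: w)
  qed
  have bc: "sinhs r1 r2 (- \<i> * A) (\<i> * B) 1 = 0"
    using E1 by (simp add: sinhs_def)
  have zero: "sinhs r1 r2 C D 0 = 0" for C D by (simp add: sinhs_def)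
  have "\<exists>g h. wderiv (sinhs r1 r2 A B) g \<and> wderiv g h \<and>
      g 1 + of_real (\<gamma> * kappa \<alpha>) * (LINT \<xi>|lborel. complex_of_real (mu \<alpha> \<xi>) *
        diffmode \<alpha> \<eta> l (l * sinhs r1 r2 A B 1) \<xi>) = 0"
  proof (intro exI conjI)
    show "coshs r1 r2 (A * r1) (B * r2) 1 + of_real (\<gamma> * kappa \<alpha>) *
        (LINT \<xi>|lborel. complex_of_real (mu \<alpha> \<xi>) * diffmode \<alpha> \<eta> l (l * sinhs r1 r2 A B 1) \<xi>) = 0"
      using E2 unfolding mu_diffmode integral_mult_right_zero diffK_def[symmetric]
      by (simp add: coshs_def sinhs_def)
  qed (rule wderiv_sinhs wderiv_coshs)+
  moreover have "integrable lborel (\<lambda>\<xi>. complex_of_real (mu \<alpha> \<xi>) * diffmode \<alpha> \<eta> l c \<xi>)" for c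
    unfolding mu_diffmode using diffK_integrable[OF assms(1-4)] by (intro integrable_mult_right)
  ultimately show ?thesis
    unfolding mode_def inDA.simps inH.simps diffmode_equation[OF assms(3,4)]
    using w xw lw bc zero H1_sinhs H2_sinhs H1_cmult_sinhs
      L2_continuous[OF continuous_on_sinhs[of _ r1 r2 "l * _" "l * _"]]
    by (simp add: sinhs_cmult H1_def)
qed

section \<open>Exponential solutions in time\<close>

lemma exp_difference_quotient:
  "((\<lambda>h. complex_of_real (1 / h) * (exp (l * of_real (t + h)) - exp (l * of_real t)) - l * exp (l * of_real t))
     \<longlongrightarrow> 0) (at 0 within S)"
proof -
  have "((\<lambda>z. exp (l * z)) has_field_derivative l * exp (l * of_real t)) (at (of_real t))"
    by (auto intro!: derivative_eq_intros)
  then have lim: "((\<lambda>h. (exp (l * (of_real t + h)) - exp (l * of_real t)) / h) \<longlongrightarrow> l * exp (l * of_real t)) (at 0)"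
    by (simp add: DERIV_def)
  have "filterlim complex_of_real (at 0) (at 0 within S)"
    unfolding filterlim_at
    by (auto intro!: tendsto_eq_intros simp: eventually_at_filter)
  from filterlim_compose[OF lim this]
  have "((\<lambda>h. (exp (l * (of_real t + of_real h)) - exp (l * of_real t)) / of_real h - l * exp (l * of_real t))
     \<longlongrightarrow> l * exp (l * of_real t) - l * exp (l * of_real t)) (at 0 within S)"
    by (intro tendsto_diff tendsto_const)
  then show ?thesis by (simp add: mult.commute)
qed

text \<open>The difference quotient minus AU(t) is the fixed mode times a scalar, so convergence in
  the energy norm reduces to differentiating exp(lt).\<close>

lemma classical_solution_mode:
  assumes "0 < \<alpha>" and "\<alpha> < 1" and "\<eta> > 0" and "Re l \<ge> - \<eta> / 2"
    and r: "r1\<^sup>2 = l\<^sup>2 - \<i> * of_real b * l" "r2\<^sup>2 = l\<^sup>2 + \<i> * of_real b * l"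
    and E1: "A * sinh r1 = B * sinh r2"
    and E2: "A * r1 * cosh r1 + B * r2 * cosh r2
      + of_real (\<gamma> * kappa \<alpha>) * (l * (A * sinh r1 + B * sinh r2) * diffK \<alpha> \<eta> l) = 0"
  shows "classical_solution \<alpha> \<eta> \<gamma> b
    (\<lambda>t. mode \<alpha> \<eta> l r1 r2 (exp (l * of_real t) * A) (exp (l * of_real t) * B))"
  unfolding classical_solution_def
proof (intro allI impI conjI exI)
  fix t :: real
  let ?e = "\<lambda>t. exp (l * complex_of_real t)"
  \<comment> \<open>The boundary equations are homogeneous in the amplitudes, so the factor exp(lt)
    preserves them.\<close>
  have "?e t * A * r1 * cosh r1 + ?e t * B * r2 * cosh r2 + of_real (\<gamma> * kappa \<alpha>) *
      (l * (?e t * A * sinh r1 + ?e t * B * sinh r2) * diffK \<alpha> \<eta> l)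
    = ?e t * (A * r1 * cosh r1 + B * r2 * cosh r2
      + of_real (\<gamma> * kappa \<alpha>) * (l * (A * sinh r1 + B * sinh r2) * diffK \<alpha> \<eta> l))"
    by (simp add: algebra_simps)
  then show "inDA \<alpha> \<eta> \<gamma> (mode \<alpha> \<eta> l r1 r2 (?e t * A) (?e t * B))"
    using E1 E2 by (intro inDA_mode assms(1-4)) (simp_all add: mult.assoc)
  show "Ahas \<alpha> \<eta> b (mode \<alpha> \<eta> l r1 r2 (?e t * A) (?e t * B))
      (mode \<alpha> \<eta> l r1 r2 (l * (?e t * A)) (l * (?e t * B)))"
    by (rule Ahas_mode[OF assms(3,4) r])
  let ?q = "\<lambda>h. complex_of_real (1 / h) * (?e (t + h) - ?e t) - l * ?e t"
  have "normH \<alpha> \<gamma> (st_sub (st_scale (complex_of_real (1 / h))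
      (st_sub (mode \<alpha> \<eta> l r1 r2 (?e (t + h) * A) (?e (t + h) * B)) (mode \<alpha> \<eta> l r1 r2 (?e t * A) (?e t * B))))
      (mode \<alpha> \<eta> l r1 r2 (l * (?e t * A)) (l * (?e t * B))))
    = cmod (?q h) * normH \<alpha> \<gamma> (mode \<alpha> \<eta> l r1 r2 A B)" for h
    unfolding mode_diff mode_cmult normH_mode_cmult[symmetric] by (simp only: algebra_simps)
  moreover have "((\<lambda>h. cmod (?q h) * normH \<alpha> \<gamma> (mode \<alpha> \<eta> l r1 r2 A B)) \<longlongrightarrow> 0) (at 0 within {h. t + h \<ge> 0})"
    by (intro tendsto_mult_left_zero tendsto_norm_zero exp_difference_quotient)
  ultimately show "((\<lambda>h. normH \<alpha> \<gamma> (st_sub (st_scale (complex_of_real (1 / h))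
      (st_sub (mode \<alpha> \<eta> l r1 r2 (?e (t + h) * A) (?e (t + h) * B)) (mode \<alpha> \<eta> l r1 r2 (?e t * A) (?e t * B))))
      (mode \<alpha> \<eta> l r1 r2 (l * (?e t * A)) (l * (?e t * B))))) \<longlongrightarrow> 0) (at 0 within {h. t + h \<ge> 0})"
    by (simp only:)
qed

text \<open>The characteristic equation is the vanishing of the determinant of the 2 by 2 linear
  system for \<open>A\<close> and \<open>B\<close>. If both \<open>sinh\<close> values vanish, the
  first equation is void and the amplitudes are chosen to solve the second.\<close>

lemma exists_amplitudes:
  fixes r1 r2 d :: complex
  assumes "r1 \<noteq> 0"
    and "r2 \<noteq> 0"
    and char: "r1 * cosh r1 * sinh r2 + r2 * cosh r2 * sinh r1 + 2 * d * sinh r1 * sinh r2 = 0"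
  shows "\<exists>A B. (A \<noteq> 0 \<or> B \<noteq> 0) \<and> A * sinh r1 = B * sinh r2 \<and>
    A * r1 * cosh r1 + B * r2 * cosh r2 + d * (A * sinh r1 + B * sinh r2) = 0"
proof (cases "sinh r1 = 0 \<and> sinh r2 = 0")
  case True
  \<comment> \<open>Makes the first amplitude \<open>r2 * cosh r2\<close> nonzero.\<close>
  have "cosh r2 \<noteq> 0" using True sinh_square_eq[of r2] by auto
  with True assms(1,2) show ?thesis
    by (intro exI[of _ "r2 * cosh r2"] exI[of _ "- r1 * cosh r1"]) auto
next
  case False
  with char show ?thesis
    by (intro exI[of _ "sinh r2"] exI[of _ "sinh r1"]) (auto simp: algebra_simps)
qed

section \<open>Slow modes contradict a uniform decay rate\<close>

theorem theorem3p1: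
  fixes \<alpha> \<eta> \<gamma> b :: real
  assumes "0 < \<alpha>" and "\<alpha> < 1" and "\<eta> > 0" and "\<gamma> > 0" and "b \<noteq> 0"
    and "\<forall>k1 k2 :: int. (k1, k2) \<noteq> (0, 0) \<longrightarrow>
           b \<noteq> pi / sqrt 2 * (real_of_int k1 ^ 2 - real_of_int k2 ^ 2)
                 / sqrt (real_of_int k1 ^ 2 + real_of_int k2 ^ 2)"
  shows "\<not> unif_exp_stable \<alpha> \<eta> \<gamma> b"
proof
  assume "unif_exp_stable \<alpha> \<eta> \<gamma> b"
  then obtain M \<omega> where "\<omega> > 0" and stable: "\<And>U t. classical_solution \<alpha> \<eta> \<gamma> b U \<Longrightarrow> t \<ge> 0 \<Longrightarrow>
      normH \<alpha> \<gamma> (U t) \<le> M * exp (- \<omega> * t) * normH \<alpha> \<gamma> (U 0)"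
    unfolding unif_exp_stable_def by blast
  \<comment> \<open>The bound \<eta>/2 keeps \<open>l\<close> where \<open>diffK\<close> is
    controlled; \<omega>/2 makes the mode decay at most half as fast as the assumed rate.\<close>
  define \<delta> where "\<delta> = min (\<eta> / 2) (\<omega> / 2)"
  have \<delta>: "\<delta> > 0" "\<delta> \<le> \<eta> / 2" "\<delta> \<le> \<omega> / 2"
    using \<open>\<eta> > 0\<close> \<open>\<omega> > 0\<close> by (auto simp: \<delta>_def)
  define c where "c = complex_of_real (2 * \<gamma> * kappa \<alpha>)"
  have c: "cmod c > 0"
    using \<open>\<gamma> > 0\<close> kappa_pos[OF assms(1,2)] by (simp add: c_def)
  \<comment> \<open>Requiring Im l > |b| excludes l = ib and l = -ib, so neither \<open>r1\<close>
    nor \<open>r2\<close> vanishes.\<close>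
  have "\<exists>l r1 r2. Re l \<ge> - \<delta> \<and> Im l > \<bar>b\<bar> \<and> l \<noteq> 0
      \<and> r1\<^sup>2 = l\<^sup>2 - \<i> * of_real b * l \<and> r2\<^sup>2 = l\<^sup>2 + \<i> * of_real b * l
      \<and> r1 * cosh r1 * sinh r2 + r2 * cosh r2 * sinh r1 + l * (c * diffK \<alpha> \<eta> l) * sinh r1 * sinh r2 = 0"
  proof (rule characteristic_root[OF \<delta>(1)])
    show "continuous_on {l. - \<delta> \<le> Re l} (\<lambda>l. c * diffK \<alpha> \<eta> l)"
      using \<delta>(2) by (intro continuous_intros continuous_on_subset[OF diffK_continuous[OF assms(1-3)]]) auto
    fix e :: real assume "e > 0"
    then have "e / cmod c > 0" using c by simp
    from diffK_decay[OF assms(1-3) this] obtain R where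
      "\<And>l. Re l \<ge> - \<eta> / 2 \<Longrightarrow> Im l \<ge> R \<Longrightarrow> cmod (diffK \<alpha> \<eta> l) < e / cmod c" by blast
    then show "\<exists>R. \<forall>l. - \<delta> \<le> Re l \<and> R \<le> Im l \<longrightarrow> cmod (c * diffK \<alpha> \<eta> l) < e"
      using \<delta>(2) c by (intro exI[of _ R]) (auto simp: norm_mult pos_less_divide_eq mult.commute)
  qed
  then obtain l r1 r2 where l: "Re l \<ge> - \<delta>" "Im l > \<bar>b\<bar>" "l \<noteq> 0"
    and r: "r1\<^sup>2 = l\<^sup>2 - \<i> * of_real b * l" "r2\<^sup>2 = l\<^sup>2 + \<i> * of_real b * l"
    and char: "r1 * cosh r1 * sinh r2 + r2 * cosh r2 * sinh r1
      + l * (c * diffK \<alpha> \<eta> l) * sinh r1 * sinh r2 = 0"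
    by blast
  have Re: "Re l \<ge> - \<eta> / 2" using l(1) \<delta>(2) by simp
  have "l - \<i> * of_real b \<noteq> 0" "l + \<i> * of_real b \<noteq> 0"
    using l(2) by (auto simp: complex_eq_iff)
  moreover have "r1\<^sup>2 = l * (l - \<i> * of_real b)" "r2\<^sup>2 = l * (l + \<i> * of_real b)"
    unfolding r by (simp_all add: power2_eq_square algebra_simps)
  ultimately have r0: "r1 \<noteq> 0" "r2 \<noteq> 0" using l(3) by auto
  have char': "r1 * cosh r1 * sinh r2 + r2 * cosh r2 * sinh r1
      + 2 * (of_real (\<gamma> * kappa \<alpha>) * l * diffK \<alpha> \<eta> l) * sinh r1 * sinh r2 = 0"
    using char by (simp add: c_def mult_ac)
  obtain A B where AB: "A \<noteq> 0 \<or> B \<noteq> 0" and E1: "A * sinh r1 = B * sinh r2"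
    and E2: "A * r1 * cosh r1 + B * r2 * cosh r2
      + of_real (\<gamma> * kappa \<alpha>) * l * diffK \<alpha> \<eta> l * (A * sinh r1 + B * sinh r2) = 0"
    using exists_amplitudes[OF r0 char'] by blast
  let ?U = "\<lambda>t. mode \<alpha> \<eta> l r1 r2 (exp (l * of_real t) * A) (exp (l * of_real t) * B)"
  have sol: "classical_solution \<alpha> \<eta> \<gamma> b ?U"
    using E2 by (intro classical_solution_mode[OF assms(1-3) Re r E1]) (simp add: mult_ac)
  define N where "N = normH \<alpha> \<gamma> (mode \<alpha> \<eta> l r1 r2 A B)"
  have N: "N > 0"
    unfolding N_def by (rule normH_mode_pos[OF assms(4,1,2) r0 AB])
  \<comment> \<open>Dividing the stability estimate by the positive norm \<open>N\<close> leaves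
    exp(-\<omega>t/2) \<le> exp(t Re l) \<le> M exp(-\<omega>t).\<close>
  have M: "exp (\<omega> / 2 * t) \<le> M" if "t \<ge> 0" for t
  proof -
    have "exp (Re l * t) * N \<le> M * exp (- \<omega> * t) * N"
      using stable[OF sol that] by (simp add: normH_mode_cmult N_def norm_exp_eq_Re)
    then have "exp (Re l * t) \<le> M * exp (- \<omega> * t)" using N by simp
    moreover have "exp (- (\<omega> / 2) * t) \<le> exp (Re l * t)"
      using l(1) \<delta>(3) mult_right_mono[OF _ that, of "- (\<omega> / 2)" "Re l"] by simp
    ultimately have "exp (- (\<omega> / 2) * t) \<le> M * exp (- \<omega> * t)" by linarith
    then have "exp (- (\<omega> / 2) * t) * exp (\<omega> * t) \<le> M * exp (- \<omega> * t) * exp (\<omega> * t)"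
      by (rule mult_right_mono) simp
    then show ?thesis by (simp add: mult.assoc flip: exp_add)
  qed
  \<comment> \<open>This makes t = 2M/\<omega> an admissible time, at which the bound reads exp M
    \<le> M, against exp M \<ge> 1 + M.\<close>
  have "M \<ge> 1" using M[of 0] by simp
  then have "exp M \<le> M" using M[of "2 * M / \<omega>"] \<open>\<omega> > 0\<close> by simp
  then show False using exp_ge_add_one_self[of M] by simp
qed

end
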